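(* Let $n\ge2$ and let \[ \pi>\mu_1\ge\cdots\ge\mu_n>-\pi/2,\qquad \mu_1-\mu_n<\pi . \] If $\mu_1>\pi/2$, then there exists a sectorial matrix $M_\mu\in\mathbb{C}^{n\times n}$ with phases $\phi(M_\mu)=(\mu_1,\ldots,\mu_n)$ such that \[ \theta_{\mathbb{R}}(M_\mu)=\pi-\mu_1=\theta_{\mathbb{C}}(M_\mu). \]
   Context: For a square matrix $A$, $\operatorname{H}(A)=\tfrac12(A+A^* )$, and $\succ0$ means positive definite. A matrix $A\in\mathbb{C}^{n\times n}$ is *sectorial* if $0$ is not in its numerical range $\{x^*Ax: x\in\mathbb{C}^n,\|x\|=1\}$. A sectorial $A$ can be written as $A=T^*\operatorname{diag}(e^{\mathrm{i}\phi_1},\ldots,e^{\mathrm{i}\phi_n})T$ with $T\in\mathbb{C}^{n\times n}$ invertible and $\phi_1\ge\cdots\ge\phi_n$ in an interval of length strictly less than $\pi$; once the interval is chosen (a choice only affects all phases by a common multiple of $2\pi$) these numbers are uniquely determined and are called the *phases* $\phi(A)=(\phi_1(A),\ldots,\phi_n(A))$. We fix the choice so that $\tfrac12(\phi_1(A)+\phi_n(A))\in(-\pi,\pi]$. In particular, real $\Delta$ with $\operatorname{H}(\Delta)\succ0$ are sectorial with phases in $(-\pi/2,\pi/2)$. The numbers $\phi_1(A)$ and $\phi_n(A)$ are the largest and smallest arguments of $x^*Ax$ over unit $x\in\mathbb{C}^n$. The complex and real angular stability radii of a sectorial $M\in\mathbb{C}^{n\times n}$ are \[ \theta_{\mathbb{C}}(M):=\inf\{\max\{|\phi_1(\Delta)|,|\phi_n(\Delta)|\}:\Delta\in\mathbb{C}^{n\times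 n}\text{ sectorial},\ \det(I+M\Delta)=0\}, \] \[ \theta_{\mathbb{R}}(M):=\inf\{\phi_1(\Delta):\Delta\in\mathbb{R}^{n\times n},\ \operatorname{H}(\Delta)\succ0,\ \det(I+M\Delta)=0\}, \] with $\inf\emptyset=+\infty$. *)

theory Defs
  imports
    Complex_Main
    "HOL-Library.Extended_Real"
    "Jordan_Normal_Form.Determinant"
    "Jordan_Normal_Form.Schur_Decomposition"
begin

(* The scalar product of Jordan_Normal_Form conjugates its second argument, so
   (A *v x) \<bullet>c x  is  x^* A x,  and  x \<bullet>c x = 1  says that x has Euclidean norm 1. *)
definition numerical_range :: "complex mat \<Rightarrow> complex set" where
  "numerical_range A =
     {(A *\<^sub>v x) \<bullet>c x | x. x \<in> carrier_vec (dim_row A) \<and> x \<bullet>c x = 1}"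

definition sectorial :: "complex mat \<Rightarrow> bool" where
  "sectorial A \<longleftrightarrow> square_mat A \<and> 0 \<notin> numerical_range A"

definition herm_part :: "complex mat \<Rightarrow> complex mat" where
  "herm_part A = (1 / 2) \<cdot>\<^sub>m (A + mat_adjoint A)"

definition pos_def :: "complex mat \<Rightarrow> bool" where
  "pos_def A \<longleftrightarrow> square_mat A \<and> mat_adjoint A = A \<and>
     (\<forall>x \<in> carrier_vec (dim_row A). x \<noteq> 0\<^sub>v (dim_row A) \<longrightarrow> 0 < Re ((A *\<^sub>v x) \<bullet>c x))"

(* has_phases A \<phi>  means  \<phi>(A) = (\<phi>_1, ..., \<phi>_n),  where  \<phi> ! i  is  \<phi>_(i+1).
   Every sectorial matrix has such a list. The length of the interval and the
   normalisation of its midpoint make the list unique, so the relation is the graph of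
   the function  A \<mapsto> \<phi>(A)  on sectorial matrices. *)
definition has_phases :: "complex mat \<Rightarrow> real list \<Rightarrow> bool" where
  "has_phases A \<phi> \<longleftrightarrow>
     (let n = dim_row A in
       length \<phi> = n \<and> sorted_wrt (\<ge>) \<phi> \<and> \<phi> ! 0 - \<phi> ! (n - 1) < pi \<and>
       (\<phi> ! 0 + \<phi> ! (n - 1)) / 2 \<in> {-pi<..pi} \<and>
       (\<exists>T \<in> carrier_mat n n. invertible_mat T \<and>
          A = mat_adjoint T * mat_diag n (\<lambda>i. exp (\<i> * complex_of_real (\<phi> ! i))) * T))"

(* Infima are taken in ereal, where the infimum of the empty set is \<infinity>. *)
definition theta_C :: "complex mat \<Rightarrow> ereal" where
  "theta_C M =
     (let n = dim_row M in
       Inf {ereal (max \<bar>\<phi> ! 0\<bar> \<bar>\<phi> ! (n - 1)\<bar>) | \<Delta> \<phi>.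
              \<Delta> \<in> carrier_mat n n \<and> sectorial \<Delta> \<and> has_phases \<Delta> \<phi> \<and>
              det (1\<^sub>m n + M * \<Delta>) = 0})"

definition theta_R :: "complex mat \<Rightarrow> ereal" where
  "theta_R M =
     (let n = dim_row M in
       Inf {ereal (\<phi> ! 0) | (\<Delta> :: real mat) \<phi>.
              \<Delta> \<in> carrier_mat n n \<and>
              pos_def (herm_part (map_mat complex_of_real \<Delta>)) \<and>
              has_phases (map_mat complex_of_real \<Delta>) \<phi> \<and>
              det (1\<^sub>m n + M * map_mat complex_of_real \<Delta>) = 0})"

end

theory Submission
  imports Defs
begin

text \<open>
  If \<open>det (I + M \<Delta>) = 0\<close>, pick \<open>v \<noteq> 0\<close> with \<open>M \<Delta> v = -v\<close> and put \<open>y = \<Delta> v\<close>. Then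
  \<open>y\<^sup>* M y = - cnj (v\<^sup>* \<Delta> v)\<close>, so an argument of \<open>v\<^sup>* \<Delta> v\<close> and an argument of \<open>y\<^sup>* M y\<close>, the latter
  in \<open>[\<mu>\<^sub>n, \<mu>\<^sub>1]\<close>, add up to an odd multiple of \<open>\<pi>\<close>. As \<open>\<mu>\<^sub>1 + \<mu>\<^sub>n > 0\<close>, this forces
  \<open>\<bar>arg (v\<^sup>* \<Delta> v)\<bar> \<ge> \<pi> - \<mu>\<^sub>1\<close>, which bounds both radii from below.

  Both bounds are attained by normal matrices with a common unitary diagonalisation: for
  \<open>\<delta> = \<pi> - \<mu>\<^sub>1\<close>, the rotation by \<open>\<delta>\<close> in the plane of the first and last coordinates is real with
  phases \<open>(\<delta>, 0, \<dots>, 0, -\<delta>)\<close>. Taking \<open>M\<close> with eigenvalues \<open>exp (\<i> \<mu>\<^sub>k)\<close> in the same eigenbasis makes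
  the first eigenvalue of \<open>M \<Delta>\<close> equal to \<open>exp (\<i> \<pi>) = -1\<close>.
\<close>

section \<open>Adjoints and Hermitian parts\<close>

lemma mat_adjoint_dim [simp]:
  "dim_row (mat_adjoint A) = dim_col A" "dim_col (mat_adjoint A) = dim_row A"
  by (auto simp: mat_adjoint_def)

lemma mat_adjoint_carrier:
  "A \<in> carrier_mat m n \<Longrightarrow> mat_adjoint A \<in> carrier_mat n m"
  by (metis carrier_matD carrier_matI mat_adjoint_dim)

lemma mat_adjoint_index [simp]:
  fixes A :: "complex mat"
  assumes "i < dim_col A" "j < dim_row A"
  shows "mat_adjoint A $$ (i, j) = cnj (A $$ (j, i))"
  using assms by (auto simp: mat_adjoint_def mat_of_rows_def)

lemma mat_adjoint_mult_vec_cscalar: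
  fixes A :: "complex mat"
  assumes A: "A \<in> carrier_mat m n" and x: "x \<in> carrier_vec n" and y: "y \<in> carrier_vec m"
  shows "(mat_adjoint A *\<^sub>v y) \<bullet>c x = y \<bullet>c (A *\<^sub>v x)"
proof -
  have adj: "(mat_adjoint A *\<^sub>v y) $ i = (\<Sum>j<m. cnj (A $$ (j, i)) * y $ j)" if "i < n" for i
    using that A y mat_adjoint_carrier[OF A]
    by (auto simp: scalar_prod_def atLeast0LessThan intro!: sum.cong)
  have "(mat_adjoint A *\<^sub>v y) \<bullet>c x = (\<Sum>i<n. \<Sum>j<m. cnj (A $$ (j, i)) * y $ j * cnj (x $ i))"
    using x by (simp add: scalar_prod_def adj sum_distrib_right atLeast0LessThan del: index_mult_mat_vec)
  also have "\<dots> = (\<Sum>j<m. \<Sum>i<n. cnj (A $$ (j, i)) * y $ j * cnj (x $ i))"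
    by (rule sum.swap)
  also have "\<dots> = y \<bullet>c (A *\<^sub>v x)"
    using assms
    by (auto simp: scalar_prod_def sum_distrib_left atLeast0LessThan mult_ac intro!: sum.cong)
  finally show ?thesis .
qed

lemma cscalar_commute:
  fixes x y :: "complex vec"
  assumes "x \<in> carrier_vec n" "y \<in> carrier_vec n"
  shows "x \<bullet>c y = cnj (y \<bullet>c x)"
  using assms by (auto simp: scalar_prod_def mult.commute intro!: sum.cong)

lemma herm_part_carrier [simp]:
  "A \<in> carrier_mat n n \<Longrightarrow> herm_part A \<in> carrier_mat n n"
  by (auto simp: herm_part_def mat_adjoint_carrier)

text \<open>The forms of \<open>A\<close> and of its adjoint at \<open>x\<close> are complex
  conjugates, so averaging them keeps the real part.\<close>

lemma herm_part_cscalar: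
  assumes A: "A \<in> carrier_mat n n" and x: "x \<in> carrier_vec n"
  shows "Re ((herm_part A *\<^sub>v x) \<bullet>c x) = Re ((A *\<^sub>v x) \<bullet>c x)"
proof -
  have adj: "mat_adjoint A \<in> carrier_mat n n" using A by (rule mat_adjoint_carrier)
  have Ax: "A *\<^sub>v x \<in> carrier_vec n" and adjx: "mat_adjoint A *\<^sub>v x \<in> carrier_vec n"
    using A adj x by auto
  have "herm_part A *\<^sub>v x = (1 / 2) \<cdot>\<^sub>v (A *\<^sub>v x + mat_adjoint A *\<^sub>v x)"
    using A adj x unfolding herm_part_def
    by (intro eq_vecI) (auto simp: smult_scalar_prod_distrib[of _ n] add_scalar_prod_distrib[of _ n]
        row_add row_smult)
  then have "(herm_part A *\<^sub>v x) \<bullet>c x =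
      (1 / 2) * ((A *\<^sub>v x) \<bullet>c x + (mat_adjoint A *\<^sub>v x) \<bullet>c x)"
    using Ax adjx x by (simp add: add_scalar_prod_distrib[of _ n] smult_scalar_prod_distrib[of _ n])
  also have "(mat_adjoint A *\<^sub>v x) \<bullet>c x = cnj ((A *\<^sub>v x) \<bullet>c x)"
    by (simp only: mat_adjoint_mult_vec_cscalar[OF A x x] cscalar_commute[OF x Ax])
  finally show ?thesis by (simp add: complex_add_cnj)
qed

text \<open>A Hermitian part is self-adjoint by construction, which leaves only the positivity
  clause of \<open>pos_def\<close>.\<close>

lemma pos_def_herm_part_iff:
  assumes A: "A \<in> carrier_mat n n"
  shows "pos_def (herm_part A) \<longleftrightarrow>
    (\<forall>x \<in> carrier_vec n. x \<noteq> 0\<^sub>v n \<longrightarrow> 0 < Re ((A *\<^sub>v x) \<bullet>c x))"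
proof -
  let ?H = "herm_part A"
  have adj: "mat_adjoint A \<in> carrier_mat n n" using A by (rule mat_adjoint_carrier)
  have H: "?H \<in> carrier_mat n n" using A by simp
  have "mat_adjoint ?H = ?H"
  proof (rule eq_matI)
    fix i j assume "i < dim_row ?H" "j < dim_col ?H"
    then have ij: "i < n" "j < n" using H by auto
    have "mat_adjoint ?H $$ (i, j) = cnj (?H $$ (j, i))"
      using H ij by simp
    also have "\<dots> = ?H $$ (i, j)"
      using ij A adj by (simp add: herm_part_def add.commute)
    finally show "mat_adjoint ?H $$ (i, j) = ?H $$ (i, j)" .
  qed (use H mat_adjoint_carrier[OF H] in auto)
  then show ?thesis
    using H by (auto simp: pos_def_def herm_part_cscalar[OF A])
qed

section \<open>Phases and arguments of the quadratic form\<close>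

lemma mult_mat_zero_vec:
  "A \<in> carrier_mat m n \<Longrightarrow> A *\<^sub>v 0\<^sub>v n = 0\<^sub>v m"
  by (auto simp: scalar_prod_def)

lemma invertible_mat_mult_vec_nonzero:
  fixes T :: "'a :: comm_ring_1 mat"
  assumes T: "T \<in> carrier_mat n n" and inv: "invertible_mat T"
    and x: "x \<in> carrier_vec n" "x \<noteq> 0\<^sub>v n"
  shows "T *\<^sub>v x \<noteq> 0\<^sub>v n"
proof
  assume zero: "T *\<^sub>v x = 0\<^sub>v n"
  obtain B where TB: "T * B = 1\<^sub>m n" and BT: "B * T = 1\<^sub>m (dim_row B)"
    using inv T by (auto simp: invertible_mat_def inverts_mat_def)
  have "dim_row B = n" "dim_col B = n"
    using arg_cong[OF BT, of dim_col] arg_cong[OF TB, of dim_col] T by auto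
  then have B: "B \<in> carrier_mat n n" by auto
  have "x = B *\<^sub>v (T *\<^sub>v x)"
    using BT B T x by (metis assoc_mult_mat_vec carrier_matD(1) one_mult_mat_vec)
  also have "\<dots> = 0\<^sub>v n" using zero B by (simp add: mult_mat_zero_vec)
  finally show False using x(2) by contradiction
qed

text \<open>Moving the adjoint of \<open>T\<close> across the scalar product turns the form into a
  conic combination of the diagonal entries.\<close>

lemma diagonal_congruence_cscalar:
  fixes T :: "complex mat"
  assumes T: "T \<in> carrier_mat n n" and x: "x \<in> carrier_vec n"
  shows "((mat_adjoint T * mat_diag n d * T) *\<^sub>v x) \<bullet>c x =
    (\<Sum>i<n. of_real ((cmod ((T *\<^sub>v x) $ i))\<^sup>2) * d i)"
proof -
  have adj: "mat_adjoint T \<in> carrier_mat n n" using T by (rule mat_adjoint_carrier)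
  have Tx: "T *\<^sub>v x \<in> carrier_vec n" using T x by simp
  have D: "mat_diag n d *\<^sub>v (T *\<^sub>v x) \<in> carrier_vec n"
    by (rule mult_mat_vec_carrier[OF mat_diag_dim Tx])
  have Dvec: "(mat_diag n d *\<^sub>v y) $ i = d i * y $ i" if "i < n" "y \<in> carrier_vec n" for i y
    using that by (auto simp: mat_diag_def scalar_prod_def if_distrib[of "\<lambda>z. z * _"] cong: if_cong)
  have "(mat_adjoint T * mat_diag n d * T) *\<^sub>v x = mat_adjoint T *\<^sub>v (mat_diag n d *\<^sub>v (T *\<^sub>v x))"
    using T adj x Tx by (simp add: assoc_mult_mat_vec[of _ n n _ n] mult_carrier_mat[of _ n n])
  then have "((mat_adjoint T * mat_diag n d * T) *\<^sub>v x) \<bullet>c x =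
      (mat_diag n d *\<^sub>v (T *\<^sub>v x)) \<bullet>c (T *\<^sub>v x)"
    using mat_adjoint_mult_vec_cscalar[OF T x D] by simp
  also have "\<dots> = (\<Sum>i<n. (d i * (T *\<^sub>v x) $ i) * cnj ((T *\<^sub>v x) $ i))"
    using T Dvec[OF _ Tx] by (simp add: scalar_prod_def atLeast0LessThan del: index_mult_mat_vec)
  also have "\<dots> = (\<Sum>i<n. of_real ((cmod ((T *\<^sub>v x) $ i))\<^sup>2) * d i)"
    by (intro sum.cong refl) (simp only: complex_norm_square mult_ac)
  finally show ?thesis .
qed

text \<open>A convex cone with opening below \<pi> contains the conic combinations of its elements.
  The result is an actual angle in the interval, not one modulo 2\<pi>, since phases may lie outside
  the range of \<open>Arg\<close>.\<close>

lemma conic_combination_polar: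
  fixes w \<theta> :: "'a \<Rightarrow> real"
  assumes I: "finite I" "k \<in> I" and w: "\<And>i. i \<in> I \<Longrightarrow> 0 \<le> w i" "0 < w k"
    and \<theta>: "\<And>i. i \<in> I \<Longrightarrow> a \<le> \<theta> i" "\<And>i. i \<in> I \<Longrightarrow> \<theta> i \<le> b" and ab: "b - a < pi"
  obtains r \<psi> where "0 < r" "a \<le> \<psi>" "\<psi> \<le> b" "(\<Sum>i\<in>I. of_real (w i) * cis (\<theta> i)) = rcis r \<psi>"
proof -
  \<comment> \<open>Subtracting the bisecting angle \<open>c\<close> makes the cone symmetric about
    the positive real axis, with half-opening \<open>h\<close> below \<pi>/2.\<close>
  define c h where "c = (a + b) / 2" and "h = (b - a) / 2"
  define z where "z = (\<Sum>i\<in>I. of_real (w i) * cis (\<theta> i - c))"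
  define t where "t = Arg z"
  have h: "0 \<le> h" "h < pi / 2"
    using \<theta>[OF I(2)] ab by (auto simp: h_def)
  have \<theta>h: "- h \<le> \<theta> i - c" "\<theta> i - c \<le> h" if "i \<in> I" for i
    using \<theta>[OF that] by (auto simp: c_def h_def field_simps)
  have rot: "z * cis s = (\<Sum>i\<in>I. of_real (w i) * cis (\<theta> i - c + s))" for s
    by (simp add: z_def sum_distrib_right cis_mult mult.assoc)
  have polar: "z * cis s = rcis (cmod z) (t + s)" for s
    by (metis cis_rcis_eq rcis_cmod_Arg rcis_mult mult.right_neutral t_def)
  have cos_pos: "0 < cos (\<theta> i - c)" if "i \<in> I" for i
    using \<theta>h[OF that] h by (intro cos_gt_zero_pi) auto
  have "0 < (\<Sum>i\<in>I. w i * cos (\<theta> i - c))"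
    using I w cos_pos by (intro sum_pos2[of _ k]) (auto intro!: mult_nonneg_nonneg simp: less_imp_le)
  also have "\<dots> = Re z"
    by (simp add: z_def)
  also have "\<dots> = cmod z * cos t"
    by (metis Re_rcis rcis_cmod_Arg t_def)
  finally have Re: "0 < cmod z * cos t" .
  then have z: "0 < cmod z"
    by (metis less_eq_real_def mult_zero_left norm_ge_zero less_irrefl)
  \<comment> \<open>A positive real part excludes the value \<pi> of \<open>Arg\<close>. The signs
    of two sines then locate \<open>t\<close> relative to the edges \<open>h\<close> and
    \<open>- h\<close>.\<close>
  have t: "- pi < t" "t < pi"
    using Arg_bounded[of z] Re z by (auto simp: t_def less_le)
  have Im: "cmod z * sin (t + s) = (\<Sum>i\<in>I. w i * sin (\<theta> i - c + s))" for s
    using arg_cong[OF trans[OF polar[symmetric] rot], of Im s] by simp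
  \<comment> \<open>Turning by \<open>- h\<close> puts the upper edge on the real axis and every
    generator into the closed lower half plane; turning by \<open>h\<close> later is the mirror
    image.\<close>
  have "sin (\<theta> i - c + - h) \<le> 0" if "i \<in> I" for i
  proof -
    have "0 \<le> sin (- (\<theta> i - c + - h))"
      using \<theta>h[OF that] h by (intro sin_ge_zero) linarith+
    then show ?thesis by (simp only: sin_minus neg_0_le_iff_le)
  qed
  then have "(\<Sum>i\<in>I. w i * sin (\<theta> i - c + - h)) \<le> 0"
    using w by (intro sum_nonpos mult_nonneg_nonpos)
  then have "sin (t + - h) \<le> 0"
    using Im[of "- h"] z by (metis mult_pos_pos not_le)
  then have "t \<le> h"
    using sin_gt_zero[of "t + - h"] t h by force
  have sin_pos: "0 \<le> sin (\<theta> i - c + h)" if "i \<in> I" for i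
    using \<theta>h[OF that] h by (intro sin_ge_zero) linarith+
  have "0 \<le> (\<Sum>i\<in>I. w i * sin (\<theta> i - c + h))"
    using sin_pos w by (intro sum_nonneg mult_nonneg_nonneg)
  then have "0 \<le> sin (t + h)"
    using Im[of h] z by (metis mult_pos_neg not_le)
  then have "- h \<le> t"
    using sin_gt_zero[of "- (t + h)", unfolded sin_minus] t h by force
  show ?thesis
  proof
    show "0 < cmod z" by (rule z)
    show "a \<le> t + c" "t + c \<le> b"
      using \<open>t \<le> h\<close> \<open>- h \<le> t\<close> by (auto simp: c_def h_def field_simps)
    show "(\<Sum>i\<in>I. of_real (w i) * cis (\<theta> i)) = rcis (cmod z) (t + c)"
      using rot[of c] polar[of c] by simp
  qed
qed

text \<open>Invertibility of \<open>T\<close> keeps some weight positive, so the value is a nonzero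
  element of the cone spanned by the unit numbers at the phases.\<close>

lemma has_phases_cscalar:
  assumes ph: "has_phases A \<phi>" and A: "A \<in> carrier_mat n n"
    and x: "x \<in> carrier_vec n" "x \<noteq> 0\<^sub>v n"
  obtains r \<psi> where "0 < r" "\<phi> ! (n - 1) \<le> \<psi>" "\<psi> \<le> \<phi> ! 0" "(A *\<^sub>v x) \<bullet>c x = rcis r \<psi>"
proof -
  have dim: "dim_row A = n" using A by simp
  obtain T where T: "T \<in> carrier_mat n n" "invertible_mat T"
    and AT: "A = mat_adjoint T * mat_diag n (\<lambda>i. exp (\<i> * complex_of_real (\<phi> ! i))) * T"
    and len: "length \<phi> = n" and srt: "sorted_wrt (\<ge>) \<phi>" and gap: "\<phi> ! 0 - \<phi> ! (n - 1) < pi"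
    using ph dim by (auto simp: has_phases_def Let_def)
  have mono: "\<phi> ! j \<le> \<phi> ! i" if "i \<le> j" "j < n" for i j
    using srt that len by (cases "i = j") (auto simp: sorted_wrt_iff_nth_less)
  have "T *\<^sub>v x \<noteq> 0\<^sub>v n"
    using invertible_mat_mult_vec_nonzero T x by blast
  moreover have "T *\<^sub>v x \<in> carrier_vec n" using T x by simp
  ultimately obtain k where k: "k < n" "(T *\<^sub>v x) $ k \<noteq> 0"
    by (metis carrier_vecD eq_vecI index_zero_vec(1,2))
  have *: "(A *\<^sub>v x) \<bullet>c x = (\<Sum>i\<in>{..<n}. of_real ((cmod ((T *\<^sub>v x) $ i))\<^sup>2) * cis (\<phi> ! i))"
    unfolding AT diagonal_congruence_cscalar[OF T(1) x(1)] by (simp add: cis_conv_exp)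
  show ?thesis
  proof (rule conic_combination_polar[of "{..<n}" k "\<lambda>i. (cmod ((T *\<^sub>v x) $ i))\<^sup>2" "\<phi> ! (n - 1)"
        "\<lambda>i. \<phi> ! i" "\<phi> ! 0"])
    fix r \<psi>
    assume "0 < r" "\<phi> ! (n - 1) \<le> \<psi>" "\<psi> \<le> \<phi> ! 0"
      "(\<Sum>i\<in>{..<n}. of_real ((cmod ((T *\<^sub>v x) $ i))\<^sup>2) * cis (\<phi> ! i)) = rcis r \<psi>"
    then show ?thesis using that * by simp
  qed (use k gap mono in auto)
qed

lemma has_phases_imp_sectorial:
  assumes "has_phases A \<phi>" and A: "A \<in> carrier_mat n n"
  shows "sectorial A"
proof -
  have "(A *\<^sub>v x) \<bullet>c x \<noteq> 0" if x: "x \<in> carrier_vec n" "x \<bullet>c x = 1" for x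
  proof -
    have "x \<noteq> 0\<^sub>v n" using x by auto
    then obtain r \<psi> where "0 < r" "(A *\<^sub>v x) \<bullet>c x = rcis r \<psi>"
      using has_phases_cscalar[OF assms x(1)] by metis
    then show ?thesis by simp
  qed
  then have "0 \<notin> numerical_range A"
    using A unfolding numerical_range_def mem_Collect_eq by (metis carrier_matD(1))
  then show ?thesis
    using A by (simp add: sectorial_def)
qed

section \<open>Lower bounds for both radii\<close>

text \<open>The bound covers every argument of the value, so it applies to an angle between the
  phases and also to the negative of the angle found at the conjugate vector.\<close>

lemma singular_perturbation_arg_bound:
  assumes M: "M \<in> carrier_mat n n" and \<Delta>: "\<Delta> \<in> carrier_mat n n"
    and ph: "has_phases M \<mu>" and pos: "0 < \<mu> ! 0 + \<mu> ! (n - 1)"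
    and sing: "det (1\<^sub>m n + M * \<Delta>) = 0"
  obtains v where "v \<in> carrier_vec n" "v \<noteq> 0\<^sub>v n"
    "\<And>r \<psi>. 0 < r \<Longrightarrow> (\<Delta> *\<^sub>v v) \<bullet>c v = rcis r \<psi> \<Longrightarrow> pi - \<mu> ! 0 \<le> \<bar>\<psi>\<bar>"
proof -
  have MD: "M * \<Delta> \<in> carrier_mat n n" using M \<Delta> by simp
  obtain v where v: "v \<in> carrier_vec n" "v \<noteq> 0\<^sub>v n" and "(1\<^sub>m n + M * \<Delta>) *\<^sub>v v = 0\<^sub>v n"
    using sing det_0_iff_vec_prod_zero[of "1\<^sub>m n + M * \<Delta>" n] MD by auto
  define y where "y = \<Delta> *\<^sub>v v"
  have y: "y \<in> carrier_vec n" using \<Delta> v by (simp add: y_def)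
  have My: "M *\<^sub>v y \<in> carrier_vec n" using M y by simp
  have "(1\<^sub>m n + M * \<Delta>) *\<^sub>v v = v + M *\<^sub>v y"
    using add_mult_distrib_mat_vec[OF one_carrier_mat MD v(1)] assoc_mult_mat_vec[OF M \<Delta> v(1)] v
    by (simp add: y_def)
  then have "v + M *\<^sub>v y = 0\<^sub>v n" using \<open>_ = 0\<^sub>v n\<close> by simp
  then have v_eq: "M *\<^sub>v y = - v"
    using v(1) My by (auto simp: vec_eq_iff add_eq_0_iff)
  have "y \<noteq> 0\<^sub>v n"
  proof
    assume "y = 0\<^sub>v n"
    then have "- v = 0\<^sub>v n" using v_eq M by (simp add: mult_mat_zero_vec)
    then show False using v by (metis uminus_zero_vec_eq)
  qed
  show ?thesis
  proof (rule that[OF v])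
    fix r \<psi> assume r: "0 < r" and eq: "(\<Delta> *\<^sub>v v) \<bullet>c v = rcis r \<psi>"
    obtain s m where s: "0 < s" and m: "\<mu> ! (n - 1) \<le> m" "m \<le> \<mu> ! 0"
      and sm: "(M *\<^sub>v y) \<bullet>c y = rcis s m"
      using has_phases_cscalar[OF ph M y \<open>y \<noteq> 0\<^sub>v n\<close>] .
    have "(M *\<^sub>v y) \<bullet>c y = - cnj (rcis r \<psi>)"
      using v_eq eq cscalar_commute[OF v(1) y] v(1) \<Delta> by (simp add: y_def)
    \<comment> \<open>Multiplying by \<open>cis \<psi>\<close> leaves a negative real on the right,
      so \<open>m + \<psi>\<close> is an odd multiple of \<pi>.\<close>
    then have "rcis s m * cis \<psi> = - cnj (rcis r \<psi>) * cis \<psi>"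
      using sm by simp
    also have "\<dots> = - of_real r"
      by (simp add: rcis_def mult.assoc cis_cnj cis_mult)
    finally have "rcis s (m + \<psi>) = - of_real r"
      by (simp add: rcis_def mult.assoc cis_mult)
    then have "s * cos (m + \<psi>) = - r" "s * sin (m + \<psi>) = 0"
      by (auto simp: complex_eq_iff)
    then have cos: "cos (m + \<psi>) < 0" and sin: "sin (m + \<psi>) = 0"
      using r s by (auto simp: mult_less_0_iff dest!: arg_cong[where f = "\<lambda>x. x < 0"])
    show "pi - \<mu> ! 0 \<le> \<bar>\<psi>\<bar>"
    proof (rule ccontr)
      assume "\<not> ?thesis"
      \<comment> \<open>The left inequality rests on \<open>pos\<close>. Inside this interval the
        sine vanishes only at 0, where the cosine is positive.\<close>
      then have "- pi < m + \<psi>" "m + \<psi> < pi" using m pos by auto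
      then show False using sin cos sin_eq_0_pi by fastforce
    qed
  qed
qed

text \<open>A real matrix commutes with entrywise conjugation of vectors.\<close>

lemma real_mat_cscalar_conjugate:
  fixes \<Delta> :: "real mat"
  assumes "\<Delta> \<in> carrier_mat n n" and "v \<in> carrier_vec n"
  shows "(map_mat complex_of_real \<Delta> *\<^sub>v conjugate v) \<bullet>c conjugate v =
    cnj ((map_mat complex_of_real \<Delta> *\<^sub>v v) \<bullet>c v)"
  using assms by (auto simp: scalar_prod_def intro!: sum.cong)

text \<open>An angle between the extreme phases is in modulus at most the larger of their
  moduli.\<close>

lemma theta_C_ge:
  assumes M: "M \<in> carrier_mat n n" and ph: "has_phases M \<mu>" and pos: "0 < \<mu> ! 0 + \<mu> ! (n - 1)"
  shows "ereal (pi - \<mu> ! 0) \<le> theta_C M"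
proof -
  have *: "pi - \<mu> ! 0 \<le> max \<bar>\<phi> ! 0\<bar> \<bar>\<phi> ! (n - 1)\<bar>"
    if \<Delta>: "\<Delta> \<in> carrier_mat n n" "has_phases \<Delta> \<phi>" "det (1\<^sub>m n + M * \<Delta>) = 0" for \<Delta> \<phi>
  proof -
    obtain v where v: "v \<in> carrier_vec n" "v \<noteq> 0\<^sub>v n"
      and bound: "\<And>r \<psi>. 0 < r \<Longrightarrow> (\<Delta> *\<^sub>v v) \<bullet>c v = rcis r \<psi> \<Longrightarrow> pi - \<mu> ! 0 \<le> \<bar>\<psi>\<bar>"
      using singular_perturbation_arg_bound[OF M \<Delta>(1) ph pos \<Delta>(3)] by metis
    obtain r \<psi> where "0 < r" "\<phi> ! (n - 1) \<le> \<psi>" "\<psi> \<le> \<phi> ! 0" "(\<Delta> *\<^sub>v v) \<bullet>c v = rcis r \<psi>"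
      using has_phases_cscalar[OF \<Delta>(2,1) v] .
    then show ?thesis using bound[of r \<psi>] by auto
  qed
  show ?thesis
    unfolding theta_C_def Let_def carrier_matD(1)[OF M]
    by (intro Inf_greatest, elim CollectE exE conjE, hypsubst, unfold ereal_less_eq)
      (rule *, assumption+)
qed

text \<open>Since \<open>theta_R\<close> sees only the largest phase, a negative angle at
  \<open>v\<close> would evade the bound; for real \<Delta> the conjugate vector then has the
  opposite, positive angle.\<close>

lemma theta_R_ge:
  assumes M: "M \<in> carrier_mat n n" and ph: "has_phases M \<mu>" and pos: "0 < \<mu> ! 0 + \<mu> ! (n - 1)"
    and obtuse: "pi / 2 < \<mu> ! 0" "\<mu> ! 0 < pi"
  shows "ereal (pi - \<mu> ! 0) \<le> theta_R M"
proof -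
  have *: "pi - \<mu> ! 0 \<le> \<phi> ! 0"
    if \<Delta>: "\<Delta> \<in> carrier_mat n n" "pos_def (herm_part (map_mat complex_of_real \<Delta>))"
      "has_phases (map_mat complex_of_real \<Delta>) \<phi>"
      "det (1\<^sub>m n + M * map_mat complex_of_real \<Delta>) = 0" for \<Delta> :: "real mat" and \<phi>
  proof (rule ccontr)
    assume "\<not> ?thesis"
    then have less: "\<phi> ! 0 < pi - \<mu> ! 0" by simp
    let ?D = "map_mat complex_of_real \<Delta>"
    have D: "?D \<in> carrier_mat n n" using \<Delta> by simp
    obtain v where v: "v \<in> carrier_vec n" "v \<noteq> 0\<^sub>v n"
      and bound: "\<And>r \<psi>. 0 < r \<Longrightarrow> (?D *\<^sub>v v) \<bullet>c v = rcis r \<psi> \<Longrightarrow> pi - \<mu> ! 0 \<le> \<bar>\<psi>\<bar>"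
      using singular_perturbation_arg_bound[OF M D ph pos \<Delta>(4)] by metis
    have "\<phi> ! 0 - \<phi> ! (n - 1) < pi" "- pi < (\<phi> ! 0 + \<phi> ! (n - 1)) / 2"
      using \<Delta>(1,3) by (auto simp: has_phases_def Let_def)
    \<comment> \<open>The midpoint condition gives this if the largest phase is at most -\<pi>/2,
      the spread below \<pi> otherwise.\<close>
    then have low: "- (3 * pi / 2) \<le> \<phi> ! (n - 1)"
      using less obtuse by (cases "\<phi> ! 0 \<le> - pi / 2") auto
    have polar: "\<exists>r \<psi>. 0 < r \<and> - pi / 2 < \<psi> \<and> \<psi> \<le> \<phi> ! 0 \<and> (?D *\<^sub>v u) \<bullet>c u = rcis r \<psi>"
      if u: "u \<in> carrier_vec n" "u \<noteq> 0\<^sub>v n" for u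
    proof -
      obtain r \<psi> where r: "0 < r" and \<psi>: "\<phi> ! (n - 1) \<le> \<psi>" "\<psi> \<le> \<phi> ! 0"
        and eq: "(?D *\<^sub>v u) \<bullet>c u = rcis r \<psi>"
        using has_phases_cscalar[OF \<Delta>(3) D u] .
      have "0 < Re ((?D *\<^sub>v u) \<bullet>c u)"
        using \<Delta>(2) u pos_def_herm_part_iff[OF D] by blast
      then have "0 < cos \<psi>" using eq r by (simp add: zero_less_mult_iff)
      \<comment> \<open>By \<open>low\<close> such an angle lies in [-3\<pi>/2, -\<pi>/2], so adding
        \<pi> brings it to where the cosine is nonnegative.\<close>
      moreover have "cos \<psi> \<le> 0" if "\<psi> \<le> - pi / 2"
        using cos_ge_zero[of "\<psi> + pi"] that low \<psi> by simp
      ultimately show ?thesis using r \<psi> eq by force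
    qed
    obtain r \<psi> where 1: "0 < r" "- pi / 2 < \<psi>" "\<psi> \<le> \<phi> ! 0" "(?D *\<^sub>v v) \<bullet>c v = rcis r \<psi>"
      using polar[OF v] by blast
    obtain s \<chi> where 2: "0 < s" "- pi / 2 < \<chi>" "\<chi> \<le> \<phi> ! 0"
      "(?D *\<^sub>v conjugate v) \<bullet>c conjugate v = rcis s \<chi>"
      using polar[of "conjugate v"] v by auto
    have conj: "rcis s \<chi> = cnj (rcis r \<psi>)"
      using 1(4) 2(4) real_mat_cscalar_conjugate[OF \<Delta>(1) v(1)] by simp
    have "rcis r \<psi> = cnj (rcis s \<chi>)" by (simp add: conj)
    then have "rcis r \<psi> = rcis s (- \<chi>)" by (simp add: rcis_def cis_cnj)
    \<comment> \<open>Both moduli reach \<open>pi - \<mu> ! 0\<close> while both angles stay below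
      it. Two conjugate values would then both have negative imaginary part.\<close>
    then have "\<psi> < 0" "\<chi> < 0"
      using bound[OF 1(1,4)] bound[of s "- \<chi>"] 1 2 less obtuse by auto
    then have "0 < sin (- \<psi>)" "0 < sin (- \<chi>)"
      using 1 2 by (intro sin_gt_zero; simp)+
    moreover have "s * sin \<chi> = - (r * sin \<psi>)"
      using arg_cong[OF conj, of Im] by simp
    ultimately show False
      using 1(1) 2(1) by (smt (verit) mult_pos_neg sin_minus)
  qed
  show ?thesis
    unfolding theta_R_def Let_def carrier_matD(1)[OF M]
    by (intro Inf_greatest, elim CollectE exE conjE, hypsubst, unfold ereal_less_eq)
      (rule *, assumption+)
qed

section \<open>Unitary eigenbasis of the rotations\<close>

text \<open>
  The rows are the adjoints of the eigenvectors \<open>(e\<^sub>1 - \<i> e\<^sub>n) / sqrt 2\<close>, \<open>e\<^sub>2, \<dots>, e\<^sub>n\<^sub>-\<^sub>1\<close>,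
  \<open>(e\<^sub>1 + \<i> e\<^sub>n) / sqrt 2\<close> of the rotations in the plane of the first and last coordinates.
\<close>

definition rotation_basis :: "nat \<Rightarrow> complex mat" where
  "rotation_basis n = mat n n (\<lambda>(i, j).
     if i = 0 then (of_bool (j = 0) + \<i> * of_bool (j = n - 1)) / of_real (sqrt 2)
     else if i = n - 1 then (of_bool (j = 0) - \<i> * of_bool (j = n - 1)) / of_real (sqrt 2)
     else of_bool (j = i))"

lemma rotation_basis_carrier [simp]: "rotation_basis n \<in> carrier_mat n n"
  by (simp add: rotation_basis_def)

lemma rotation_basis_unitary:
  assumes "2 \<le> n"
  shows "rotation_basis n * mat_adjoint (rotation_basis n) = 1\<^sub>m n"
proof (rule eq_matI)
  let ?T = "rotation_basis n"
  note adj = mat_adjoint_carrier[OF rotation_basis_carrier[of n]]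
  have row: "(\<Sum>j<n. ?T $$ (i, j) * g j) =
      (if i = 0 then (g 0 + \<i> * g (n - 1)) / of_real (sqrt 2)
       else if i = n - 1 then (g 0 - \<i> * g (n - 1)) / of_real (sqrt 2) else g i)"
    if "i < n" for i g
  proof -
    have "of_bool P * x = (if P then x else 0)" for P and x :: complex by simp
    then show ?thesis
      using that assms
      by (auto simp: rotation_basis_def add_divide_distrib diff_divide_distrib ring_distribs
          sum.distrib sum_subtractf mult.assoc simp flip: sum_divide_distrib sum_distrib_left)
  qed
  fix i k assume "i < dim_row (1\<^sub>m n)" "k < dim_col (1\<^sub>m n)"
  then have ik: "i < n" "k < n" by auto
  have sqrt: "complex_of_real (sqrt 2) * complex_of_real (sqrt 2) = 2"
    by (simp flip: of_real_mult)
  have "(?T * mat_adjoint ?T) $$ (i, k) = (\<Sum>j<n. ?T $$ (i, j) * cnj (?T $$ (k, j)))"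
    using ik adj carrier_matD[OF rotation_basis_carrier[of n]]
    by (simp add: scalar_prod_def atLeast0LessThan)
  also have "\<dots> = 1\<^sub>m n $$ (i, k)"
    using ik assms by (simp add: row) (auto simp: rotation_basis_def sqrt field_simps)
  finally show "(?T * mat_adjoint ?T) $$ (i, k) = 1\<^sub>m n $$ (i, k)" .
qed (use mat_adjoint_carrier[OF rotation_basis_carrier[of n]] in auto)

lemma invertible_rotation_basis:
  assumes "2 \<le> n"
  shows "invertible_mat (rotation_basis n)"
proof -
  note adj = mat_adjoint_carrier[OF rotation_basis_carrier[of n]]
  note unitary = rotation_basis_unitary[OF assms]
  have "mat_adjoint (rotation_basis n) * rotation_basis n = 1\<^sub>m n"
    using mat_mult_left_right_inverse[OF rotation_basis_carrier adj unitary] .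
  then show ?thesis
    using unitary adj carrier_matD[OF rotation_basis_carrier[of n]]
    unfolding invertible_mat_def inverts_mat_def by auto
qed

text \<open>Complex conjugation swaps the first and last basis vectors together with their eigenvalues.\<close>

lemma rotation_real:
  assumes n: "2 \<le> n" and d: "d (n - 1) = cnj (d 0)"
    and mid: "\<And>i. 0 < i \<Longrightarrow> i < n - 1 \<Longrightarrow> d i \<in> \<real>" and ij: "i < n" "j < n"
  shows "(mat_adjoint (rotation_basis n) * mat_diag n d * rotation_basis n) $$ (i, j) \<in> \<real>"
proof -
  let ?T = "rotation_basis n"
  let ?f = "\<lambda>k. cnj (?T $$ (k, i)) * d k * ?T $$ (k, j)"
  note adj = mat_adjoint_carrier[OF rotation_basis_carrier[of n]]
  have "(mat_adjoint ?T * mat_diag n d * ?T) $$ (i, j) = (\<Sum>k<n. ?f k)"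
    using ij adj carrier_matD[OF rotation_basis_carrier[of n]]
    by (simp add: mat_diag_mult_right[OF adj] scalar_prod_def atLeast0LessThan)
  \<comment> \<open>The conjugate pair is split off; as \<open>2 \<le> n\<close>, its two indices
    differ. In the remaining terms all factors are real.\<close>
  also have "{..<n} = insert 0 (insert (n - 1) {0<..<n - 1})"
    using n by auto
  also have "(\<Sum>k\<in>\<dots>. ?f k) = ?f 0 + ?f (n - 1) + (\<Sum>k\<in>{0<..<n - 1}. ?f k)"
    using n by simp
  also have "?f (n - 1) = cnj (?f 0)"
    using n ij d by (simp add: rotation_basis_def)
  also have "?f 0 + cnj (?f 0) + (\<Sum>k\<in>{0<..<n - 1}. ?f k) \<in> \<real>"
  proof (rule Reals_add)
    show "?f 0 + cnj (?f 0) \<in> \<real>" by (simp only: complex_add_cnj Reals_of_real)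
    show "(\<Sum>k\<in>{0<..<n - 1}. ?f k) \<in> \<real>"
      using ij mid by (intro sum_in_Reals Reals_mult) (auto simp: rotation_basis_def)
  qed
  finally show ?thesis .
qed

text \<open>In the common eigenbasis the sum is diagonal with entries \<open>1 + d i * e i\<close>,
  and the one at \<open>k\<close> vanishes.\<close>

lemma unitary_diagonalisation_singular:
  fixes T :: "complex mat"
  assumes T: "T \<in> carrier_mat n n" and unitary: "T * mat_adjoint T = 1\<^sub>m n"
    and k: "k < n" "d k * e k = - 1"
  shows "det (1\<^sub>m n + (mat_adjoint T * mat_diag n d * T) * (mat_adjoint T * mat_diag n e * T)) = 0"
proof -
  let ?S = "mat_adjoint T" and ?E = "mat_diag n (\<lambda>i. d i * e i)"
    and ?F = "mat_diag n (\<lambda>i. 1 + d i * e i)"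
  have S: "?S \<in> carrier_mat n n" using T by (rule mat_adjoint_carrier)
  have ST: "?S * T = 1\<^sub>m n"
    using mat_mult_left_right_inverse[OF T S unitary] .
  have "(?S * mat_diag n d * T) * (?S * mat_diag n e * T) =
      ?S * mat_diag n d * (T * ?S) * mat_diag n e * T"
    using S T by (simp add: assoc_mult_mat[of _ n n _ n _ n] mult_carrier_mat[of _ n n _ n])
  also have "\<dots> = ?S * (mat_diag n d * mat_diag n e) * T"
    using S T unitary
    by (simp add: assoc_mult_mat[of _ n n _ n _ n] mult_carrier_mat[of _ n n _ n]
        left_mult_one_mat[of _ n n] del: mat_diag_diag)
  \<comment> \<open>The identity is rewritten as a congruence by \<open>T\<close>, so that it can be
    added to the diagonal part.\<close>
  finally have "1\<^sub>m n + (?S * mat_diag n d * T) * (?S * mat_diag n e * T) =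
      ?S * 1\<^sub>m n * T + ?S * ?E * T"
    using ST right_mult_one_mat[OF S] by simp
  also have "\<dots> = ?S * (1\<^sub>m n + ?E) * T"
    unfolding mult_add_distrib_mat[OF S one_carrier_mat mat_diag_dim]
    by (rule add_mult_distrib_mat[OF mult_carrier_mat mult_carrier_mat T, symmetric])
      (rule S one_carrier_mat mat_diag_dim)+
  also have "1\<^sub>m n + ?E = ?F" by (rule eq_matI) (auto simp: mat_diag_def)
  finally have eq: "1\<^sub>m n + (?S * mat_diag n d * T) * (?S * mat_diag n e * T) = ?S * ?F * T" .
  have "det ?F = prod_list (diag_mat ?F)"
    by (rule det_upper_triangular[OF _ mat_diag_dim]) (auto simp: mat_diag_def upper_triangular_def)
  also have "\<dots> = 0"
    using k by (auto simp: prod_list_zero_iff diag_mat_def mat_diag_def image_iff intro!: bexI[of _ k])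
  finally have "det ?F = 0" .
  then show ?thesis
    unfolding eq using S T
    by (simp add: det_mult[of _ n] mult_carrier_mat[of _ n n _ n])
qed

section \<open>The extremal pair of matrices\<close>

theorem proposition2p4:
  fixes n :: nat and \<mu> :: "real list"
  assumes "n \<ge> 2" and "length \<mu> = n"
    and "sorted_wrt (\<ge>) \<mu>"
    and "\<mu> ! 0 < pi" and "\<mu> ! (n - 1) > - pi / 2"
    and "\<mu> ! 0 - \<mu> ! (n - 1) < pi"
    and "\<mu> ! 0 > pi / 2"
  shows "\<exists>M \<in> carrier_mat n n. sectorial M \<and> has_phases M \<mu> \<and>
           theta_R M = ereal (pi - \<mu> ! 0) \<and> theta_C M = ereal (pi - \<mu> ! 0)"
proof -
  define T where "T = rotation_basis n"
  define eig where "eig \<phi> = (\<lambda>i. exp (\<i> * complex_of_real (\<phi> ! i)))" for \<phi> :: "real list"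
  define normal where "normal \<phi> = mat_adjoint T * mat_diag n (eig \<phi>) * T" for \<phi>
  define \<delta> where "\<delta> = pi - \<mu> ! 0"
  define \<phi> where "\<phi> = map (\<lambda>i. if i = 0 then \<delta> else if i = n - 1 then - \<delta> else 0) [0..<n]"
  \<comment> \<open>Taking real parts gives the type of real matrices; it loses nothing, as
    \<open>normal \<phi>\<close> has real entries.\<close>
  define \<Delta> where "\<Delta> = map_mat Re (normal \<phi>)"
  have T: "T \<in> carrier_mat n n" "invertible_mat T" "T * mat_adjoint T = 1\<^sub>m n"
    using assms(1) by (simp_all add: T_def invertible_rotation_basis rotation_basis_unitary)
  have normal: "normal \<psi> \<in> carrier_mat n n" for \<psi>
    unfolding normal_def by (intro mult_carrier_mat[of _ n n _ n] mat_adjoint_carrier T(1) mat_diag_dim)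
  have \<delta>: "0 < \<delta>" "\<delta> < pi / 2" using assms by (auto simp: \<delta>_def)
  have \<phi>: "length \<phi> = n" "\<phi> ! 0 = \<delta>" "\<phi> ! (n - 1) = - \<delta>"
    "\<And>i. 0 < i \<Longrightarrow> i < n - 1 \<Longrightarrow> \<phi> ! i = 0"
    using assms(1) by (auto simp: \<phi>_def)
  \<comment> \<open>With \<open>\<mu> ! 0 < pi\<close> this keeps the midpoint of the phases below
    \<pi>.\<close>
  have "\<mu> ! (n - 1) \<le> \<mu> ! 0"
    using assms by (auto simp: sorted_wrt_iff_nth_less)
  then have phM: "has_phases (normal \<mu>) \<mu>"
    unfolding has_phases_def Let_def using assms T carrier_matD[OF normal[of \<mu>]]
    by (auto simp: normal_def eig_def intro!: bexI[of _ T])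
  have "sorted_wrt (\<ge>) \<phi>"
    using \<delta> assms(1) by (auto simp: \<phi>_def sorted_wrt_iff_nth_less)
  \<comment> \<open>The midpoint is 0, and the spread \<open>2 * \<delta>\<close> is below \<pi>
    because \<open>\<mu> ! 0 > pi / 2\<close>.\<close>
  then have ph\<Delta>: "has_phases (normal \<phi>) \<phi>"
    unfolding has_phases_def Let_def using \<phi> \<delta> T carrier_matD[OF normal[of \<phi>]]
    by (auto simp: normal_def eig_def intro!: bexI[of _ T])
  have eig_cis: "eig \<psi> i = cis (\<psi> ! i)" for \<psi> i
    by (simp add: eig_def cis_conv_exp)
  have "eig \<phi> (n - 1) = cnj (eig \<phi> 0)"
    unfolding eig_cis \<phi> by (simp add: cis_cnj)
  moreover have "eig \<phi> i \<in> \<real>" if "0 < i" "i < n - 1" for i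
    using \<phi>(4)[OF that] by (simp add: eig_cis)
  ultimately have "normal \<phi> $$ (i, j) \<in> \<real>" if "i < n" "j < n" for i j
    unfolding normal_def T_def using rotation_real assms(1) that by blast
  then have real: "map_mat complex_of_real \<Delta> = normal \<phi>"
    using normal[of \<phi>] by (intro eq_matI) (auto simp: \<Delta>_def of_real_Re)
  have \<Delta>: "\<Delta> \<in> carrier_mat n n" using normal[of \<phi>] by (simp add: \<Delta>_def)
  have "eig \<mu> 0 * eig \<phi> 0 = - 1"
    by (simp add: eig_cis \<phi> \<delta>_def cis_mult)
  then have sing: "det (1\<^sub>m n + normal \<mu> * normal \<phi>) = 0"
    unfolding normal_def using unitary_diagonalisation_singular[OF T(1,3), of 0] assms(1) by simp
  have "pos_def (herm_part (normal \<phi>))"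
    unfolding pos_def_herm_part_iff[OF normal]
  proof (intro ballI impI)
    fix x :: "complex vec"
    assume x: "x \<in> carrier_vec n" "x \<noteq> 0\<^sub>v n"
    obtain r \<psi> where "0 < r" "- \<delta> \<le> \<psi>" "\<psi> \<le> \<delta>" "(normal \<phi> *\<^sub>v x) \<bullet>c x = rcis r \<psi>"
      using has_phases_cscalar[OF ph\<Delta> normal x] \<phi> by metis
    then show "0 < Re ((normal \<phi> *\<^sub>v x) \<bullet>c x)"
      using \<delta> by (auto intro!: mult_pos_pos cos_gt_zero_pi)
  qed
  then have "theta_R (normal \<mu>) \<le> ereal \<delta>"
    using \<Delta> ph\<Delta> sing real \<phi> carrier_matD[OF normal[of \<mu>]]
    unfolding theta_R_def Let_def by (intro Inf_lower) (auto intro!: exI[of _ \<Delta>] exI[of _ \<phi>])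
  moreover have "theta_C (normal \<mu>) \<le> ereal \<delta>"
    using normal ph\<Delta> sing \<phi> \<delta> has_phases_imp_sectorial[OF ph\<Delta> normal] carrier_matD[OF normal[of \<mu>]]
    unfolding theta_C_def Let_def by (intro Inf_lower) (auto intro!: exI[of _ "normal \<phi>"] exI[of _ \<phi>])
  \<comment> \<open>The required positivity of \<open>\<mu> ! 0 + \<mu> ! (n - 1)\<close> follows
    from the bounds \<pi>/2 and -\<pi>/2 on the two terms.\<close>
  moreover have "ereal \<delta> \<le> theta_R (normal \<mu>)" "ereal \<delta> \<le> theta_C (normal \<mu>)"
    using theta_R_ge[OF normal phM] theta_C_ge[OF normal phM] assms by (simp_all add: \<delta>_def)
  ultimately show ?thesis
    using normal phM has_phases_imp_sectorial[OF phM normal] by (auto simp: \<delta>_def intro!: bexI[of _ "normal \<mu>"])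
qed

end
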